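(* For every finite group $G$, the order graph $\mathcal{S}(G)$ is a divisor graph.
   Context: The order graph $\mathcal{S}(G)$ of a group $G$ is the undirected graph with vertex set $G$ in which two distinct vertices $x,y$ are adjacent if and only if $o(x)\mid o(y)$ or $o(y)\mid o(x)$, where $o(x)$ denotes the order of $x$. A simple undirected graph $\Gamma$ is a divisor graph if there is an injection $\alpha$ from $V(\Gamma)$ to the set of positive integers such that distinct $x,y\in V(\Gamma)$ are adjacent if and only if $\alpha(x)\mid\alpha(y)$ or $\alpha(y)\mid\alpha(x)$. *)

theory Defs
  imports "HOL-Algebra.Multiplicative_Group" "Graph_Theory.Pair_Digraph"
begin

text \<open>
  A simple undirected graph is represented, as usual in the library, by the symmetric loop-free
  digraph having both arcs \<open>(x, y)\<close> and \<open>(y, x)\<close> for every edge \<open>{x, y}\<close>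
  (\<^locale>\<open>pair_bidirected_digraph\<close>, which does not require finiteness).
\<close>

text \<open>
  The library order of an element of infinite order is \<open>0\<close>; on a finite group
  \<^const>\<open>group.ord\<close> is the usual, positive, order.
\<close>

definition order_graph :: "('a, 'b) monoid_scheme \<Rightarrow> 'a pair_pre_digraph" where
  "order_graph G =
    \<lparr> pverts = carrier G,
      parcs = {(x, y). x \<in> carrier G \<and> y \<in> carrier G \<and> x \<noteq> y \<and>
                 (group.ord G x dvd group.ord G y \<or> group.ord G y dvd group.ord G x)} \<rparr>"

definition divisor_graph :: "'a pair_pre_digraph \<Rightarrow> bool" where
  "divisor_graph \<Gamma> \<longleftrightarrow> pair_bidirected_digraph \<Gamma> \<and>
    (\<exists>\<alpha> :: 'a \<Rightarrow> nat.
       inj_on \<alpha> (pverts \<Gamma>) \<and> (\<forall>x \<in> pverts \<Gamma>. \<alpha> x > 0) \<and>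
       (\<forall>x \<in> pverts \<Gamma>. \<forall>y \<in> pverts \<Gamma>. x \<noteq> y \<longrightarrow>
          ((x, y) \<in> parcs \<Gamma> \<longleftrightarrow> \<alpha> x dvd \<alpha> y \<or> \<alpha> y dvd \<alpha> x)))"

end

theory Submission
  imports Defs "HOL-Computational_Algebra.Primes"
begin

text \<open>
  Adjacency in the order graph is comparability for a preorder on \<open>G\<close>, divisibility of element
  orders, and the comparability graph of every finite preorder is a divisor graph.  A preorder
  falls short of being a partial order only within its classes of equivalent elements, here the
  elements of equal order.  These classes are cliques, so ordering each of them linearly
  refines the preorder to a partial order with the same comparable pairs
  (\<open>preorder_refine_same_comparability\<close>).  A finite partial order in turn embeds into the positive
  integers under divisibility: assign distinct primes to the elements and send \<open>x\<close> to the
  squarefree product of the primes of the elements below \<open>x\<close>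
  (\<open>finite_partial_order_dvd_embedding\<close>).
\<close>

text \<open>
  The label of \<open>x\<close> encodes the principal down-set of \<open>x\<close> by its prime divisors, so
  divisibility of labels is inclusion of down-sets, which by reflexivity and transitivity
  is the given order; antisymmetry makes the labels distinct.
\<close>

lemma finite_partial_order_dvd_embedding:
  fixes le :: "'a \<Rightarrow> 'a \<Rightarrow> bool"
  assumes fin: "finite A"
    and refl: "reflp_on A le" and trans: "transp_on A le"
    and antisym: "antisymp_on A le"
  obtains \<alpha> :: "'a \<Rightarrow> nat"
  where "inj_on \<alpha> A" "\<And>x. x \<in> A \<Longrightarrow> \<alpha> x > 0"
    "\<And>x y. \<lbrakk>x \<in> A; y \<in> A\<rbrakk> \<Longrightarrow> \<alpha> x dvd \<alpha> y \<longleftrightarrow> le x y"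
proof -
  obtain B where B: "B \<subseteq> {p :: nat. prime p}" "finite B" "card B = card A"
    using infinite_arbitrarily_large[OF primes_infinite] by metis
  then obtain p where "bij_betw p A B"
    using fin finite_same_card_bij by metis
  then have inj: "inj_on p A" and prime: "\<And>x. x \<in> A \<Longrightarrow> prime (p x)"
    using B(1) unfolding bij_betw_def by blast+
  define \<alpha> where "\<alpha> x = (\<Prod>z \<in> {z \<in> A. le z x}. p z)" for x
  have pos: "\<alpha> x > 0" for x
    unfolding \<alpha>_def using prime by (auto intro!: prod_pos simp: prime_gt_0_nat)
  have dvd: "\<alpha> x dvd \<alpha> y \<longleftrightarrow> le x y" if xy: "x \<in> A" "y \<in> A" for x y
  proof
    assume "le x y"
    then have "{z \<in> A. le z x} \<subseteq> {z \<in> A. le z y}"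
      using xy by (auto dest: transp_onD[OF trans])
    then show "\<alpha> x dvd \<alpha> y"
      unfolding \<alpha>_def using fin by (intro prod_dvd_prod_subset) auto
  next
    assume "\<alpha> x dvd \<alpha> y"
    moreover have "p x dvd \<alpha> x"
      unfolding \<alpha>_def using fin xy reflp_onD[OF refl] by (intro dvd_prodI) auto
    ultimately have "p x dvd (\<Prod>z \<in> {z \<in> A. le z y}. p z)"
      unfolding \<alpha>_def by (rule dvd_trans[rotated])
    then obtain z where z: "z \<in> A" "le z y" "p x dvd p z"
      using fin prime[OF xy(1)] by (auto simp: prime_dvd_prod_iff)
    then have "p x = p z"
      using prime xy(1) by (simp add: primes_dvd_imp_eq)
    then show "le x y"
      using inj xy(1) z by (auto dest: inj_onD)
  qed
  have "inj_on \<alpha> A"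
  proof (rule inj_onI)
    fix x y assume "x \<in> A" "y \<in> A" "\<alpha> x = \<alpha> y"
    then show "x = y"
      using dvd[of x y] dvd[of y x] by (intro antisymp_onD[OF antisym]) auto
  qed
  then show thesis
    using that pos dvd by blast
qed

text \<open>
  Breaking ties within an equivalence class by an injective index \<open>e\<close> makes the relation
  antisymmetric.  Transitivity survives because a chain \<open>x\<close>, \<open>y\<close>, \<open>z\<close> that returns from \<open>z\<close>
  to \<open>x\<close> lies in a single class, and no comparable pair is lost because \<open>e\<close> ranges over a
  linear order.
\<close>

lemma preorder_refine_same_comparability:
  fixes le :: "'a \<Rightarrow> 'a \<Rightarrow> bool" and e :: "'a \<Rightarrow> nat"
  assumes refl: "reflp_on A le" and trans: "transp_on A le" and inj: "inj_on e A"
  defines "le' \<equiv> \<lambda>x y. le x y \<and> (le y x \<longrightarrow> e x \<le> e y)"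
  shows "reflp_on A le'" and "transp_on A le'" and "antisymp_on A le'"
    and "le' x y \<or> le' y x \<longleftrightarrow> le x y \<or> le y x"
proof -
  show "reflp_on A le'"
    using refl by (simp add: le'_def reflp_on_def)
  show "transp_on A le'"
  proof (rule transp_onI)
    fix x y z assume xyz: "x \<in> A" "y \<in> A" "z \<in> A" and "le' x y" "le' y z"
    then have le: "le x y" "le y z" and e: "le y x \<Longrightarrow> e x \<le> e y" "le z y \<Longrightarrow> e y \<le> e z"
      by (simp_all add: le'_def)
    have "e x \<le> e z" if "le z x"
    proof -
      have "le y x" "le z y"
        using xyz le that by (blast dest: transp_onD[OF trans])+
      then show ?thesis
        using e by linarith
    qed
    then show "le' x z"
      using transp_onD[OF trans xyz le] by (simp add: le'_def)
  qed
  show "antisymp_on A le'"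
    using inj by (auto simp: le'_def intro!: antisymp_onI dest: inj_onD)
  show "le' x y \<or> le' y x \<longleftrightarrow> le x y \<or> le y x"
    unfolding le'_def by auto
qed

lemma finite_preorder_dvd_comparability:
  fixes le :: "'a \<Rightarrow> 'a \<Rightarrow> bool"
  assumes fin: "finite A"
    and refl: "reflp_on A le" and trans: "transp_on A le"
  obtains \<alpha> :: "'a \<Rightarrow> nat"
  where "inj_on \<alpha> A" "\<And>x. x \<in> A \<Longrightarrow> \<alpha> x > 0"
    "\<And>x y. \<lbrakk>x \<in> A; y \<in> A\<rbrakk> \<Longrightarrow> \<alpha> x dvd \<alpha> y \<or> \<alpha> y dvd \<alpha> x \<longleftrightarrow> le x y \<or> le y x"
proof -
  obtain e :: "'a \<Rightarrow> nat" where e: "inj_on e A"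
    using finite_imp_inj_to_nat_seg[OF fin] by auto
  define le' where "le' = (\<lambda>x y. le x y \<and> (le y x \<longrightarrow> e x \<le> e y))"
  note refined = preorder_refine_same_comparability
    [OF refl trans e, folded le'_def]
  obtain \<alpha> :: "'a \<Rightarrow> nat" where \<alpha>: "inj_on \<alpha> A" "\<And>x. x \<in> A \<Longrightarrow> \<alpha> x > 0"
    "\<And>x y. \<lbrakk>x \<in> A; y \<in> A\<rbrakk> \<Longrightarrow> \<alpha> x dvd \<alpha> y \<longleftrightarrow> le' x y"
    using finite_partial_order_dvd_embedding[OF fin refined(1-3)] by blast
  show thesis
    using that[OF \<alpha>(1,2)] \<alpha>(3) refined(4) by (simp add: le'_def)
qed

lemma pair_bidirected_digraph_order_graph: "pair_bidirected_digraph (order_graph G)"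
  by unfold_locales (auto simp: order_graph_def symmetric_def intro!: symI)

theorem corollary3p4:
  fixes G :: "('a, 'b) monoid_scheme"
  assumes "group G" and "finite (carrier G)"
  shows "divisor_graph (order_graph G)"
proof -
  obtain \<alpha> :: "'a \<Rightarrow> nat"
    where "inj_on \<alpha> (carrier G)" "\<And>x. x \<in> carrier G \<Longrightarrow> \<alpha> x > 0"
      "\<And>x y. \<lbrakk>x \<in> carrier G; y \<in> carrier G\<rbrakk> \<Longrightarrow> \<alpha> x dvd \<alpha> y \<or> \<alpha> y dvd \<alpha> x \<longleftrightarrow>
        group.ord G x dvd group.ord G y \<or> group.ord G y dvd group.ord G x"
    by (rule finite_preorder_dvd_comparability
          [OF assms(2), of "\<lambda>x y. group.ord G x dvd group.ord G y"])
      (auto intro!: reflp_onI transp_onI intro: dvd_trans)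
  then show ?thesis
    unfolding divisor_graph_def
    by (intro conjI pair_bidirected_digraph_order_graph exI[of _ \<alpha>])
      (auto simp: order_graph_def)
qed

end
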